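(* Define the selector $\eta^*=(\eta^*_1,\dots,\eta^*_d)$ by $$\eta^{*}_{j} = \mathbf{1}\Big\{ f_{1}(X_{j})\prod_{i \neq j}f_{0}(X_{i}) \geq \sum_{k \neq j}\Big(f_{1}(X_{k})\prod_{i \neq k}f_{0}(X_{i})\Big) \Big\},\qquad j=1,\dots,d.$$ Let $\pi_1$ be the uniform distribution on the set $\{\eta\in\{0,1\}^d: |\eta|_0=1\}$, and let $\mathbb{E}_{\pi_1}$ denote expectation over $\eta\sim\pi_1$. Then $\eta^*$ is minimax on $\{|\eta|_0=1\}$ and Bayes with respect to $\pi_1$: $$\inf_{\tilde{\eta}} \sup_{|\eta|_{0} = 1} \mathbf{E}_{\eta} |\tilde{\eta} - \eta| = \sup_{|\eta|_{0} = 1}\mathbf{E}_{\eta} |\eta^{*} - \eta| = \mathbf{E}_{e_1} |\eta^{*} - e_1|,$$ $$\inf_{\tilde{\eta}} \ \mathbb{E}_{\pi_1} \mathbf{E}_{\eta} |\tilde{\eta} - \eta| = \mathbb{E}_{\pi_1}\mathbf{E}_{\eta} |\eta^{*} - \eta| = \mathbf{E}_{e_1} |\eta^{*} - e_1|,$$ where $\inf_{\tilde\eta}$ is the infimum over all selectors and $e_1=(1,0,\dots,0)\in\{0,1\}^d$.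
   Context: Pivotal selection problem: $d>2$ is an integer; $P_0\neq P_1$ are probability measures on a measurable space $(\mathcal X,\mathcal U)$ with densities $f_0,f_1$ with respect to a common dominating measure $\mu$. For $\eta\in\{0,1\}^d$, under $\mathbf{P}_\eta$ the observations $X_1,\dots,X_d$ are independent, with $X_j\sim P_1$ if $\eta_j=1$ and $X_j\sim P_0$ if $\eta_j=0$; $\mathbf{E}_\eta$ is the corresponding expectation. A selector is any measurable function $\tilde\eta=\tilde\eta(X_1,\dots,X_d,\zeta)$ with values in $\{0,1\}^d$, where $\zeta$ is a randomization variable with values in some measurable space, independent of $(X_1,\dots,X_d)$ (and included in $\mathbf{P}_\eta$). $|\tilde\eta-\eta|=\sum_{j=1}^d\mathbf{1}(\tilde\eta_j\ne\eta_j)$ is the Hamming loss, and $|\eta|_0$ is the number of non-zero components of $\eta$. Suprema over $|\eta|_0=1$ are over $\eta\in\{0,1\}^d$ with exactly one non-zero component. *)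

theory Defs
  imports "HOL-Probability.Probability"
begin

text \<open>Vectors in \<open>{0,1}\<^sup>d\<close> are extensional functions on the index set \<open>{1..d}\<close>.\<close>

definition cube :: "nat \<Rightarrow> (nat \<Rightarrow> nat) set" where
  "cube d = {1..d} \<rightarrow>\<^sub>E {0, 1}"

definition norm0 :: "nat \<Rightarrow> (nat \<Rightarrow> nat) \<Rightarrow> nat" where
  "norm0 d \<eta> = card {j \<in> {1..d}. \<eta> j \<noteq> 0}"

definition one_sparse :: "nat \<Rightarrow> (nat \<Rightarrow> nat) set" where
  "one_sparse d = {\<eta> \<in> cube d. norm0 d \<eta> = 1}"

definition e1 :: "nat \<Rightarrow> nat \<Rightarrow> nat" where
  "e1 d = (\<lambda>j\<in>{1..d}. if j = 1 then 1 else 0)"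

definition hamming :: "nat \<Rightarrow> (nat \<Rightarrow> nat) \<Rightarrow> (nat \<Rightarrow> nat) \<Rightarrow> real" where
  "hamming d a b = (\<Sum>j = 1..d. of_bool (a j \<noteq> b j))"

definition obs_law :: "nat \<Rightarrow> 'a measure \<Rightarrow> 'a measure \<Rightarrow> (nat \<Rightarrow> nat) \<Rightarrow> (nat \<Rightarrow> 'a) measure" where
  "obs_law d P0 P1 \<eta> = (\<Pi>\<^sub>M j\<in>{1..d}. if \<eta> j = 1 then P1 else P0)"

text \<open>A selector is a pair \<open>(Z, t)\<close> of the law \<open>Z\<close> of its randomization variable \<open>\<zeta>\<close>, on an
  arbitrary measurable space with points of type \<open>'z\<close>, and a jointly measurable function \<open>t\<close>
  of \<open>((X\<^sub>1, \<dots>, X\<^sub>d), \<zeta>)\<close>. Only the measurable space underlying \<open>M\<close> is used.\<close>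

definition selectors ::
    "nat \<Rightarrow> 'a measure \<Rightarrow> ('z measure \<times> ((nat \<Rightarrow> 'a) \<times> 'z \<Rightarrow> nat \<Rightarrow> nat)) set" where
  "selectors d M = {(Z, t). prob_space Z \<and>
     t \<in> (\<Pi>\<^sub>M j\<in>{1..d}. M) \<Otimes>\<^sub>M Z \<rightarrow>\<^sub>M (\<Pi>\<^sub>M j\<in>{1..d}. count_space {0, 1})}"

text \<open>Independence of \<open>\<zeta>\<close> and the observations makes their joint law the product measure.\<close>

definition risk :: "nat \<Rightarrow> 'a measure \<Rightarrow> 'a measure \<Rightarrow>
    'z measure \<times> ((nat \<Rightarrow> 'a) \<times> 'z \<Rightarrow> nat \<Rightarrow> nat) \<Rightarrow> (nat \<Rightarrow> nat) \<Rightarrow> real" where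
  "risk d P0 P1 s \<eta> =
     (\<integral>\<omega>. hamming d (snd s \<omega>) \<eta> \<partial>(obs_law d P0 P1 \<eta> \<Otimes>\<^sub>M fst s))"

definition bayes_risk :: "nat \<Rightarrow> 'a measure \<Rightarrow> 'a measure \<Rightarrow>
    'z measure \<times> ((nat \<Rightarrow> 'a) \<times> 'z \<Rightarrow> nat \<Rightarrow> nat) \<Rightarrow> real" where
  "bayes_risk d P0 P1 s =
     measure_pmf.expectation (pmf_of_set (one_sparse d)) (\<lambda>\<eta>. risk d P0 P1 s \<eta>)"

definition spike_density :: "nat \<Rightarrow> ('a \<Rightarrow> real) \<Rightarrow> ('a \<Rightarrow> real) \<Rightarrow> (nat \<Rightarrow> 'a) \<Rightarrow> nat \<Rightarrow> real" where
  "spike_density d f0 f1 x j = f1 (x j) * (\<Prod>i\<in>{1..d} - {j}. f0 (x i))"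

definition eta_star :: "nat \<Rightarrow> ('a \<Rightarrow> real) \<Rightarrow> ('a \<Rightarrow> real) \<Rightarrow> (nat \<Rightarrow> 'a) \<Rightarrow> nat \<Rightarrow> nat" where
  "eta_star d f0 f1 x = (\<lambda>j\<in>{1..d}.
     if spike_density d f0 f1 x j \<ge> (\<Sum>k\<in>{1..d} - {j}. spike_density d f0 f1 x k) then 1 else 0)"

text \<open>The selector that uses no randomization: \<open>\<zeta>\<close> is present but ignored.\<close>

definition star_selector :: "nat \<Rightarrow> ('a \<Rightarrow> real) \<Rightarrow> ('a \<Rightarrow> real) \<Rightarrow> 'z measure \<Rightarrow>
    'z measure \<times> ((nat \<Rightarrow> 'a) \<times> 'z \<Rightarrow> nat \<Rightarrow> nat)" where
  "star_selector d f0 f1 Z = (Z, \<lambda>\<omega>. eta_star d f0 f1 (fst \<omega>))"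

end

theory Submission
  imports Defs
begin

text \<open>Summed over the \<open>d\<close> one-sparse vectors, the risk of a selector is the integral of a sum
  over coordinates \<open>j\<close> which costs the \<open>j\<close>-th spike density when \<open>j\<close> is rejected and the sum of
  all the other ones when \<open>j\<close> is selected. The selector \<open>\<eta>\<^sup>*\<close> minimises every term pointwise,
  hence it is Bayes. By exchangeability its risk is constant on one-sparse vectors, and a Bayes
  selector of constant risk is minimax because the supremum dominates the average.\<close>

section \<open>Densities of product measures\<close>

text \<open>A product of sigma-finite measures is determined by its values on boxes. On a box the
  integrand splits into one-coordinate factors, so its integral is the product of the factor
  masses.\<close>

lemma (in product_sigma_finite) PiM_density:
  assumes I: "finite I"
    and meas: "\<And>i. h i \<in> borel_measurable (M i)"
    and sigma: "\<And>i. sigma_finite_measure (density (M i) (h i))"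
  shows "PiM I (\<lambda>i. density (M i) (h i)) = density (PiM I M) (\<lambda>x. \<Prod>i\<in>I. h i (x i))"
proof -
  note [measurable] = meas
  interpret D: product_sigma_finite "\<lambda>i. density (M i) (h i)"
    using sigma by (simp add: product_sigma_finite_def)
  show ?thesis
  proof (rule D.PiM_eqI[OF I, symmetric])
    show "sets (density (PiM I M) (\<lambda>x. \<Prod>i\<in>I. h i (x i))) = sets (PiM I (\<lambda>i. density (M i) (h i)))"
      by (simp cong: sets_PiM_cong)
  next
    fix A assume "\<And>i. i \<in> I \<Longrightarrow> A i \<in> sets (density (M i) (h i))"
    then have A: "\<And>i. i \<in> I \<Longrightarrow> A i \<in> sets (M i)" by simp
    have "emeasure (density (PiM I M) (\<lambda>x. \<Prod>i\<in>I. h i (x i))) (Pi\<^sub>E I A)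
        = (\<integral>\<^sup>+x. (\<Prod>i\<in>I. h i (x i)) * indicator (Pi\<^sub>E I A) x \<partial>PiM I M)"
      using A I by (intro emeasure_density) (auto intro!: sets_PiM_I_finite)
    also have "\<dots> = (\<integral>\<^sup>+x. (\<Prod>i\<in>I. h i (x i) * indicator (A i) (x i)) \<partial>PiM I M)"
    proof (rule nn_integral_cong)
      fix x assume x: "x \<in> space (PiM I M)"
      have "indicator (Pi\<^sub>E I A) x = (\<Prod>i\<in>I. indicator (A i) (x i) :: ennreal)"
      proof (cases "x \<in> Pi\<^sub>E I A")
        case True
        then have "(\<Prod>i\<in>I. indicator (A i) (x i) :: ennreal) = 1"
          by (intro prod.neutral) (auto dest: PiE_mem)
        with True show ?thesis by simp
      next
        \<comment> \<open>Points of the product space are extensional, so a point outside the box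
          must violate it at some index in \<open>I\<close>.\<close>
        case False
        with x obtain i where "i \<in> I" "x i \<notin> A i"
          by (auto simp: space_PiM PiE_iff)
        then have "(\<Prod>i\<in>I. indicator (A i) (x i) :: ennreal) = 0"
          using I by (intro prod_zero) (auto intro!: bexI[of _ i])
        with False show ?thesis by simp
      qed
      then show "(\<Prod>i\<in>I. h i (x i)) * indicator (Pi\<^sub>E I A) x
          = (\<Prod>i\<in>I. h i (x i) * indicator (A i) (x i))"
        by (simp add: prod.distrib)
    qed
    also have "\<dots> = (\<Prod>i\<in>I. \<integral>\<^sup>+x. h i x * indicator (A i) x \<partial>M i)"
    proof (rule product_nn_integral_prod[OF I])
      fix i assume "i \<in> I"
      from A[OF this] show "(\<lambda>x. h i x * indicator (A i) x) \<in> borel_measurable (M i)"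
        by measurable
    qed
    also have "\<dots> = (\<Prod>i\<in>I. emeasure (density (M i) (h i)) (A i))"
      using A by (intro prod.cong refl) (simp add: emeasure_density)
    finally show "emeasure (density (PiM I M) (\<lambda>x. \<Prod>i\<in>I. h i (x i))) (Pi\<^sub>E I A)
        = (\<Prod>i\<in>I. emeasure (density (M i) (h i)) (A i))" .
  qed
qed

text \<open>\<open>Z\<close> is its own density with constant 1, so the rule for a product of two
  densities applies. This carries a density of the observations over to their joint law with the
  randomization variable.\<close>

lemma density_pair_fst:
  assumes "sigma_finite_measure Z" "sigma_finite_measure M" "h \<in> borel_measurable M"
  shows "density M h \<Otimes>\<^sub>M Z = density (M \<Otimes>\<^sub>M Z) (\<lambda>\<omega>. h (fst \<omega>))"
proof -
  have "density M h \<Otimes>\<^sub>M density Z (\<lambda>_. 1) = density (M \<Otimes>\<^sub>M Z) (\<lambda>(x, y). h x * 1)"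
    using assms by (intro pair_measure_density) (simp_all add: density_1)
  then show ?thesis
    by (simp add: density_1 case_prod_beta')
qed

section \<open>One-sparse vectors and the Hamming loss\<close>

definition unit_vec :: "nat \<Rightarrow> nat \<Rightarrow> nat \<Rightarrow> nat" where
  "unit_vec d k = (\<lambda>j\<in>{1..d}. if j = k then 1 else 0)"

lemma e1_eq_unit_vec: "e1 d = unit_vec d 1"
  by (simp add: e1_def unit_vec_def)

lemma inj_on_unit_vec: "inj_on (unit_vec d) {1..d}"
proof (rule inj_onI)
  fix j k assume "j \<in> {1..d}" "k \<in> {1..d}" "unit_vec d j = unit_vec d k"
  then show "j = k"
    by (auto simp: unit_vec_def restrict_def fun_eq_iff split: if_splits dest!: spec[of _ j])
qed

lemma one_sparse_eq: "one_sparse d = unit_vec d ` {1..d}"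
proof (intro equalityI subsetI)
  fix \<eta> assume "\<eta> \<in> one_sparse d"
  then have \<eta>: "\<eta> \<in> {1..d} \<rightarrow>\<^sub>E {0, 1}" and "card {j \<in> {1..d}. \<eta> j \<noteq> 0} = 1"
    by (auto simp: one_sparse_def cube_def norm0_def)
  then obtain k where k: "{j \<in> {1..d}. \<eta> j \<noteq> 0} = {k}"
    by (auto simp: card_1_singleton_iff)
  have "\<eta> j = unit_vec d k j" for j
  proof (cases "j \<in> {1..d}")
    case True
    then have "\<eta> j \<in> {0, 1}" "\<eta> j \<noteq> 0 \<longleftrightarrow> j = k"
      using \<eta> k by blast+
    then show ?thesis
      using True by (auto simp: unit_vec_def)
  next
    \<comment> \<open>By extensionality both functions are \<open>undefined\<close> off the index
      range.\<close>
    case False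
    then show ?thesis
      using False unfolding PiE_arb[OF \<eta> False] unit_vec_def by (simp only: restrict_apply if_False)
  qed
  moreover have "k \<in> {1..d}" using k by blast
  ultimately show "\<eta> \<in> unit_vec d ` {1..d}"
    by blast
next
  fix \<eta> assume "\<eta> \<in> unit_vec d ` {1..d}"
  then obtain k where k: "k \<in> {1..d}" "\<eta> = unit_vec d k" by blast
  have "{j \<in> {1..d}. \<eta> j \<noteq> 0} = {k}"
    using k by (auto simp: unit_vec_def split: if_splits)
  then show "\<eta> \<in> one_sparse d"
    using k by (auto simp: one_sparse_def cube_def norm0_def unit_vec_def)
qed

lemma hamming_nonneg: "0 \<le> hamming d a b"
  by (simp add: hamming_def sum_nonneg)

lemma hamming_le: "hamming d a b \<le> d"
  using sum_bounded_above[of "{1..d}" "\<lambda>j. of_bool (a j \<noteq> b j)" "1::real"]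
  by (simp add: hamming_def)

lemma borel_measurable_hamming:
  assumes t: "t \<in> M \<rightarrow>\<^sub>M (\<Pi>\<^sub>M j\<in>{1..d}. count_space {0, 1})"
  shows "(\<lambda>\<omega>. hamming d (t \<omega>) \<eta>) \<in> borel_measurable M"
  unfolding hamming_def
proof (rule borel_measurable_sum)
  fix j assume j: "j \<in> {1..d}"
  have "(\<lambda>\<omega>. t \<omega> j) \<in> M \<rightarrow>\<^sub>M count_space {0, 1}"
    by (rule measurable_compose[OF t measurable_component_singleton[OF j]])
  moreover have "(\<lambda>v. of_bool (v \<noteq> \<eta> j) :: real) \<in> borel_measurable (count_space {0, 1})"
    by simp
  ultimately show "(\<lambda>\<omega>. of_bool (t \<omega> j \<noteq> \<eta> j) :: real) \<in> borel_measurable M"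
    by (rule measurable_compose)
qed

text \<open>Swapping the two sums decouples the coordinates: at coordinate \<open>j\<close> the
  value 0 disagrees only with the spike at \<open>j\<close>, while the value 1 disagrees with every
  other spike. Each coordinate of \<open>a\<close> can then be optimised separately.\<close>

lemma sum_hamming_unit_vec:
  fixes w :: "nat \<Rightarrow> real"
  assumes a: "a \<in> {1..d} \<rightarrow>\<^sub>E {0, 1}"
  shows "(\<Sum>k=1..d. w k * hamming d a (unit_vec d k))
    = (\<Sum>j=1..d. if a j = 0 then w j else \<Sum>k\<in>{1..d} - {j}. w k)"
proof -
  have "(\<Sum>k=1..d. w k * hamming d a (unit_vec d k))
      = (\<Sum>j=1..d. \<Sum>k=1..d. w k * of_bool (a j \<noteq> unit_vec d k j))"
    unfolding hamming_def sum_distrib_left by (rule sum.swap)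
  also have "\<dots> = (\<Sum>j=1..d. if a j = 0 then w j else \<Sum>k\<in>{1..d} - {j}. w k)"
  proof (rule sum.cong[OF refl])
    fix j assume j: "j \<in> {1..d}"
    then have "a j = 0 \<or> a j = 1" using a by blast
    then show "(\<Sum>k=1..d. w k * of_bool (a j \<noteq> unit_vec d k j))
        = (if a j = 0 then w j else \<Sum>k\<in>{1..d} - {j}. w k)"
      using j by (auto simp: unit_vec_def sum.remove[of _ j] intro!: sum.cong sum.neutral)
  qed
  finally show ?thesis .
qed

section \<open>Pointwise optimality and measurability of \<open>eta_star\<close>\<close>

lemma eta_star_in_cube: "eta_star d f0 f1 x \<in> {1..d} \<rightarrow>\<^sub>E {0, 1}"
  by (auto simp: eta_star_def)

text \<open>The weights \<open>w\<close> need only be proportional to the spike densities, which allows a change of the dominating measure.\<close>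

lemma eta_star_minimises:
  fixes w :: "nat \<Rightarrow> real"
  assumes a: "a \<in> {1..d} \<rightarrow>\<^sub>E {0, 1}" and "0 \<le> C"
    and scale: "\<And>k. k \<in> {1..d} \<Longrightarrow> spike_density d f0 f1 x k = C * w k"
    and zero: "\<And>k. k \<in> {1..d} \<Longrightarrow> C = 0 \<Longrightarrow> w k = 0"
  shows "(\<Sum>k=1..d. w k * hamming d (eta_star d f0 f1 x) (unit_vec d k))
    \<le> (\<Sum>k=1..d. w k * hamming d a (unit_vec d k))"
proof (cases "C = 0")
  case True
  then show ?thesis using zero by simp
next
  case False
  with \<open>0 \<le> C\<close> have "0 < C" by simp
  \<comment> \<open>A positive common factor does not affect the comparison, so
    \<open>eta_star\<close> picks the cheaper of the two costs at \<open>j\<close> in terms of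
    \<open>w\<close>. In a tie the costs agree and the value 1 is taken.\<close>
  have "eta_star d f0 f1 x j = 0 \<longleftrightarrow> w j < (\<Sum>k\<in>{1..d} - {j}. w k)" if "j \<in> {1..d}" for j
  proof -
    have "(\<Sum>k\<in>{1..d} - {j}. spike_density d f0 f1 x k) = C * (\<Sum>k\<in>{1..d} - {j}. w k)"
      unfolding sum_distrib_left by (intro sum.cong) (auto simp: scale)
    then show ?thesis
      using that scale[OF that] \<open>0 < C\<close> by (auto simp: eta_star_def)
  qed
  then show ?thesis
    unfolding sum_hamming_unit_vec[OF a] sum_hamming_unit_vec[OF eta_star_in_cube]
    by (intro sum_mono) auto
qed

lemma borel_measurable_spike_density:
  assumes [measurable]: "f0 \<in> borel_measurable M" "f1 \<in> borel_measurable M" and k: "k \<in> {1..d}"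
  shows "(\<lambda>x. spike_density d f0 f1 x k) \<in> borel_measurable (\<Pi>\<^sub>M j\<in>{1..d}. M)"
proof -
  have [measurable]: "(\<lambda>x. x i) \<in> (\<Pi>\<^sub>M j\<in>{1..d}. M) \<rightarrow>\<^sub>M M" if "i \<in> {1..d}" for i
    using that by (rule measurable_component_singleton)
  show ?thesis
    unfolding spike_density_def
  proof (intro borel_measurable_times borel_measurable_prod)
    show "(\<lambda>x. f1 (x k)) \<in> borel_measurable (\<Pi>\<^sub>M j\<in>{1..d}. M)"
      using k by measurable
    fix i assume "i \<in> {1..d} - {k}"
    then have "i \<in> {1..d}" by simp
    then show "(\<lambda>x. f0 (x i)) \<in> borel_measurable (\<Pi>\<^sub>M j\<in>{1..d}. M)"
      by measurable
  qed
qed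

lemma measurable_eta_star:
  assumes [measurable]: "f0 \<in> borel_measurable M" "f1 \<in> borel_measurable M"
  shows "eta_star d f0 f1 \<in> (\<Pi>\<^sub>M j\<in>{1..d}. M) \<rightarrow>\<^sub>M (\<Pi>\<^sub>M j\<in>{1..d}. count_space {0, 1})"
  unfolding eta_star_def
proof (rule measurable_restrict)
  fix j assume j: "j \<in> {1..d}"
  have sum: "(\<lambda>x. \<Sum>k\<in>{1..d} - {j}. spike_density d f0 f1 x k)
      \<in> borel_measurable (\<Pi>\<^sub>M j\<in>{1..d}. M)"
    by (rule borel_measurable_sum) (rule borel_measurable_spike_density[OF assms], blast)
  show "(\<lambda>x. if (\<Sum>k\<in>{1..d} - {j}. spike_density d f0 f1 x k) \<le> spike_density d f0 f1 x j
      then 1 else 0 :: nat) \<in> (\<Pi>\<^sub>M j\<in>{1..d}. M) \<rightarrow>\<^sub>M count_space {0, 1}"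
    using borel_measurable_spike_density[OF assms j] sum
    by (intro measurable_If borel_measurable_le) simp_all
qed

section \<open>Equivariance of \<open>eta_star\<close> under relabelling of coordinates\<close>

lemma bij_betw_Diff_singleton:
  assumes "bij_betw f A B" "a \<in> A"
  shows "bij_betw f (A - {a}) (B - {f a})"
  using assms by (auto simp: bij_betw_def inj_on_def)

lemma spike_density_permute:
  assumes "bij_betw \<tau> {1..d} {1..d}" and j: "j \<in> {1..d}"
  shows "spike_density d f0 f1 (\<lambda>i\<in>{1..d}. x (\<tau> i)) j = spike_density d f0 f1 x (\<tau> j)"
proof -
  have "(\<Prod>i\<in>{1..d} - {j}. f0 (x (\<tau> i))) = (\<Prod>i\<in>{1..d} - {\<tau> j}. f0 (x i))"
    by (rule prod.reindex_bij_betw[OF bij_betw_Diff_singleton[OF assms]])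
  then show ?thesis
    using j by (simp add: spike_density_def)
qed

text \<open>Each coordinate compares its own spike density with the sum of all the others, a rule
  that does not depend on the labels. Relabelling the observations therefore only relabels the
  decisions.\<close>

lemma eta_star_permute:
  assumes \<tau>: "bij_betw \<tau> {1..d} {1..d}" and j: "j \<in> {1..d}"
  shows "eta_star d f0 f1 (\<lambda>i\<in>{1..d}. x (\<tau> i)) j = eta_star d f0 f1 x (\<tau> j)"
proof -
  let ?y = "\<lambda>i\<in>{1..d}. x (\<tau> i)"
  have \<tau>j: "\<tau> j \<in> {1..d}"
    using \<tau> j by (rule bij_betw_apply)
  have "(\<Sum>k\<in>{1..d} - {j}. spike_density d f0 f1 ?y k)
      = (\<Sum>k\<in>{1..d} - {j}. spike_density d f0 f1 x (\<tau> k))"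
    using spike_density_permute[OF \<tau>] by (intro sum.cong refl) blast
  also have "\<dots> = (\<Sum>k\<in>{1..d} - {\<tau> j}. spike_density d f0 f1 x k)"
    by (rule sum.reindex_bij_betw[OF bij_betw_Diff_singleton[OF \<tau> j]])
  finally show ?thesis
    using j \<tau>j by (simp only: eta_star_def restrict_apply spike_density_permute[OF \<tau> j] if_True)
qed

section \<open>Exchangeability and the constant risk of \<open>eta_star\<close>\<close>

locale pivotal_selection =
  fixes d :: nat and \<mu> P0 P1 :: "'a measure" and f0 f1 :: "'a \<Rightarrow> real"
  assumes d_pos: "0 < d"
    and prob_P0: "prob_space P0" and prob_P1: "prob_space P1"
    and meas_f0 [measurable]: "f0 \<in> borel_measurable \<mu>"
    and nonneg_f0: "\<And>x. x \<in> space \<mu> \<Longrightarrow> 0 \<le> f0 x"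
    and meas_f1 [measurable]: "f1 \<in> borel_measurable \<mu>"
    and nonneg_f1: "\<And>x. x \<in> space \<mu> \<Longrightarrow> 0 \<le> f1 x"
    and P0_eq: "P0 = density \<mu> (\<lambda>x. ennreal (f0 x))"
    and P1_eq: "P1 = density \<mu> (\<lambda>x. ennreal (f1 x))"
begin

lemma sets_P [simp, measurable_cong]: "sets P0 = sets \<mu>" "sets P1 = sets \<mu>"
  by (simp_all add: P0_eq P1_eq)

lemma prob_space_obs_law: "prob_space (obs_law d P0 P1 \<eta>)"
  unfolding obs_law_def by (intro prob_space_PiM) (simp add: prob_P0 prob_P1)

lemma sets_obs_law [measurable_cong]: "sets (obs_law d P0 P1 \<eta>) = sets (\<Pi>\<^sub>M j\<in>{1..d}. \<mu>)"
  unfolding obs_law_def by (intro sets_PiM_cong) simp_all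

lemma star_selector_in_selectors:
  "prob_space Z \<Longrightarrow> star_selector d f0 f1 Z \<in> selectors d \<mu>"
  using measurable_compose[OF measurable_fst measurable_eta_star[OF meas_f0 meas_f1]]
  by (simp add: star_selector_def selectors_def)

text \<open>As \<open>Z\<close> has mass 1, the first marginal of the joint law is the law of the
  observations. The right-hand side is free of \<open>Z\<close>, so the randomization law can be
  exchanged at will.\<close>

lemma risk_star_selector:
  assumes "prob_space Z"
  shows "risk d P0 P1 (star_selector d f0 f1 Z) \<eta>
    = (\<integral>x. hamming d (eta_star d f0 f1 x) \<eta> \<partial>obs_law d P0 P1 \<eta>)"
proof -
  interpret Z: prob_space Z by fact
  let ?L = "obs_law d P0 P1 \<eta>"
  have [measurable]: "(\<lambda>x. hamming d (eta_star d f0 f1 x) \<eta>) \<in> borel_measurable ?L"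
    using borel_measurable_hamming[OF measurable_eta_star[OF meas_f0 meas_f1]]
    by (simp cong: measurable_cong_sets add: sets_obs_law)
  have "(\<integral>x. hamming d (eta_star d f0 f1 x) \<eta> \<partial>?L)
      = (\<integral>x. hamming d (eta_star d f0 f1 x) \<eta> \<partial>distr (?L \<Otimes>\<^sub>M Z) ?L fst)"
    by (simp add: Z.distr_pair_fst)
  also have "\<dots> = (\<integral>\<omega>. hamming d (eta_star d f0 f1 (fst \<omega>)) \<eta> \<partial>(?L \<Otimes>\<^sub>M Z))"
    by (rule integral_distr) measurable
  finally show ?thesis
    by (simp add: risk_def star_selector_def)
qed

text \<open>The transposition of 1 and \<open>k\<close> carries the law with spike at
  \<open>k\<close> to the law with spike at 1. \<open>eta_star\<close> is equivariant under it, and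
  the Hamming distance is unchanged when both arguments are relabelled alike.\<close>

lemma risk_star_selector_unit_vec:
  assumes Z: "prob_space Z" and k: "k \<in> {1..d}"
  shows "risk d P0 P1 (star_selector d f0 f1 Z) (unit_vec d k)
    = risk d P0 P1 (star_selector d f0 f1 Z) (e1 d)"
proof -
  define \<tau> where "\<tau> = Transposition.transpose 1 k"
  have one: "1 \<in> {1..d}" using d_pos by simp
  have \<tau>: "bij_betw \<tau> {1..d} {1..d}"
    unfolding \<tau>_def using one k by (simp add: permutes_imp_bij permutes_swap_id)
  have \<tau>_range: "\<tau> j \<in> {1..d}" if "j \<in> {1..d}" for j
    using \<tau> that by (rule bij_betw_apply)
  have unit_vec_\<tau>: "unit_vec d 1 j = unit_vec d k (\<tau> j)" if "j \<in> {1..d}" for j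
    using that \<tau>_range[OF that]
    by (auto simp: unit_vec_def \<tau>_def Transposition.transpose_def)
  let ?L = "\<lambda>k. obs_law d P0 P1 (unit_vec d k)"
  let ?s = "\<lambda>x. \<lambda>i\<in>{1..d}. x (\<tau> i)"
  \<comment> \<open>These are the factor laws for the spike at \<open>k\<close>; composed with
    \<tau> they become the factor laws for the spike at 1, which is the shape required by
    \<open>distr_PiM_reindex\<close>.\<close>
  define M where "M = (\<lambda>j. if unit_vec d k j = 1 then P1 else P0)"
  have L1: "?L 1 = (\<Pi>\<^sub>M j\<in>{1..d}. M (\<tau> j))"
    unfolding obs_law_def M_def by (intro PiM_cong refl) (simp only: unit_vec_\<tau>)
  have Lk: "?L k = PiM {1..d} M"
    unfolding obs_law_def M_def ..
  have L: "?L 1 = distr (?L k) (?L 1) ?s"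
    unfolding L1 Lk
  proof (rule distr_PiM_reindex[symmetric])
    show "prob_space (M i)" for i
      by (simp add: M_def prob_P0 prob_P1)
    show "inj_on \<tau> {1..d}" "\<tau> \<in> {1..d} \<rightarrow> {1..d}"
      using \<tau> \<tau>_range by (auto simp: bij_betw_def)
  qed
  have meas_s: "?s \<in> ?L k \<rightarrow>\<^sub>M ?L 1"
    unfolding L1 Lk by (intro measurable_restrict measurable_component_singleton \<tau>_range)
  have hamming: "hamming d (eta_star d f0 f1 (?s x)) (unit_vec d 1)
      = hamming d (eta_star d f0 f1 x) (unit_vec d k)" for x
  proof -
    have "hamming d (eta_star d f0 f1 (?s x)) (unit_vec d 1)
        = (\<Sum>j=1..d. of_bool (eta_star d f0 f1 x (\<tau> j) \<noteq> unit_vec d k (\<tau> j)))"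
      unfolding hamming_def
      by (intro sum.cong refl) (simp only: eta_star_permute[OF \<tau>] unit_vec_\<tau>)
    also have "\<dots> = hamming d (eta_star d f0 f1 x) (unit_vec d k)"
      unfolding hamming_def by (rule sum.reindex_bij_betw[OF \<tau>])
    finally show ?thesis .
  qed
  have meas: "(\<lambda>x. hamming d (eta_star d f0 f1 x) (unit_vec d 1)) \<in> borel_measurable (?L 1)"
    using borel_measurable_hamming[OF measurable_eta_star[OF meas_f0 meas_f1]]
    by (simp cong: measurable_cong_sets add: sets_obs_law)
  have "risk d P0 P1 (star_selector d f0 f1 Z) (e1 d)
      = (\<integral>x. hamming d (eta_star d f0 f1 x) (unit_vec d 1) \<partial>distr (?L k) (?L 1) ?s)"
    unfolding e1_eq_unit_vec risk_star_selector[OF Z] L[symmetric] ..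
  also have "\<dots> = (\<integral>x. hamming d (eta_star d f0 f1 x) (unit_vec d k) \<partial>?L k)"
    by (simp only: integral_distr[OF meas_s meas] hamming)
  finally show ?thesis
    unfolding risk_star_selector[OF Z] ..
qed

section \<open>Densities with respect to a finite dominating measure\<close>

text \<open>Since \<open>\<mu>\<close> need not be \<open>\<sigma>\<close>-finite, product densities are taken with respect to the
  finite measure \<open>P0 + P1\<close>. Where \<open>f0 + f1\<close> vanishes, both quotients are \<open>0\<close>.\<close>

definition N :: "'a measure" where
  "N = density \<mu> (\<lambda>x. ennreal (f0 x + f1 x))"

definition g0 :: "'a \<Rightarrow> real" where
  "g0 x = f0 x / (f0 x + f1 x)"

definition g1 :: "'a \<Rightarrow> real" where
  "g1 x = f1 x / (f0 x + f1 x)"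

lemma sets_N [simp, measurable_cong]: "sets N = sets \<mu>"
  by (simp add: N_def)

lemma space_N [simp]: "space N = space \<mu>"
  by (simp add: N_def)

lemma meas_g [measurable]: "g0 \<in> borel_measurable \<mu>" "g1 \<in> borel_measurable \<mu>"
  unfolding g0_def[abs_def] g1_def[abs_def] by measurable

lemma nonneg_g: "x \<in> space \<mu> \<Longrightarrow> 0 \<le> g0 x" "x \<in> space \<mu> \<Longrightarrow> 0 \<le> g1 x"
  by (simp_all add: g0_def g1_def nonneg_f0 nonneg_f1)

text \<open>Where \<open>f0 + f1\<close> vanishes, nonnegativity forces \<open>f0\<close> and
  \<open>f1\<close> to vanish as well, so both equations survive division by zero.\<close>

lemma f_eq:
  assumes "x \<in> space \<mu>"
  shows "f0 x = (f0 x + f1 x) * g0 x" "f1 x = (f0 x + f1 x) * g1 x"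
  using nonneg_f0[OF assms] nonneg_f1[OF assms]
  by (cases "f0 x + f1 x = 0"; simp add: g0_def g1_def)+

lemma P_eq_density_N: "P0 = density N (\<lambda>x. ennreal (g0 x))" "P1 = density N (\<lambda>x. ennreal (g1 x))"
proof -
  \<comment> \<open>The chain rule for densities, stated for a generic pair to cover both laws at
    once.\<close>
  have "density N (\<lambda>x. ennreal (g x)) = density \<mu> (\<lambda>x. ennreal (f x))"
    if [measurable]: "f \<in> borel_measurable \<mu>" "g \<in> borel_measurable \<mu>"
      and eq: "\<And>x. x \<in> space \<mu> \<Longrightarrow> f x = (f0 x + f1 x) * g x"
      and nonneg: "\<And>x. x \<in> space \<mu> \<Longrightarrow> 0 \<le> g x" for f g
  proof -
    have "density N (\<lambda>x. ennreal (g x))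
        = density \<mu> (\<lambda>x. ennreal (f0 x + f1 x) * ennreal (g x))"
      unfolding N_def by (rule density_density_eq) measurable
    also have "\<dots> = density \<mu> (\<lambda>x. ennreal (f x))"
    proof (intro density_cong AE_I2)
      fix x assume x: "x \<in> space \<mu>"
      then show "ennreal (f0 x + f1 x) * ennreal (g x) = ennreal (f x)"
        unfolding eq[OF x] by (simp add: ennreal_mult nonneg nonneg_f0 nonneg_f1)
    qed measurable
    finally show ?thesis .
  qed
  from this[OF _ _ f_eq(1)] this[OF _ _ f_eq(2)]
  show "P0 = density N (\<lambda>x. ennreal (g0 x))" "P1 = density N (\<lambda>x. ennreal (g1 x))"
    by (simp_all add: P0_eq P1_eq nonneg_g)
qed

text \<open>The total mass is that of \<open>P0\<close> plus that of \<open>P1\<close>, namely 2.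
  Finiteness makes \<open>N\<close> sigma-finite, hence usable as a factor of product
  measures.\<close>

lemma finite_measure_N: "finite_measure N"
proof
  interpret P0: prob_space P0 by (rule prob_P0)
  interpret P1: prob_space P1 by (rule prob_P1)
  have "emeasure N (space N) = (\<integral>\<^sup>+x. ennreal (f0 x) + ennreal (f1 x) \<partial>\<mu>)"
    by (auto simp: N_def emeasure_density nonneg_f0 nonneg_f1 intro!: nn_integral_cong)
  also have "\<dots> = emeasure P0 (space P0) + emeasure P1 (space P1)"
    by (simp add: P0_eq P1_eq emeasure_density nn_integral_add cong: nn_integral_cong)
  also have "\<dots> \<noteq> \<infinity>"
    by (simp add: P0.emeasure_space_1 P1.emeasure_space_1)
  finally show "emeasure N (space N) \<noteq> \<infinity>" .
qed

abbreviation w :: "(nat \<Rightarrow> 'a) \<Rightarrow> nat \<Rightarrow> real" where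
  "w \<equiv> spike_density d g0 g1"

lemma nonneg_w:
  assumes "x \<in> space (\<Pi>\<^sub>M j\<in>{1..d}. N)" "k \<in> {1..d}"
  shows "0 \<le> w x k"
proof -
  have "x i \<in> space \<mu>" if "i \<in> {1..d}" for i
    using assms that by (auto simp: space_PiM)
  then show ?thesis
    using assms(2) by (auto simp: spike_density_def nonneg_g intro!: mult_nonneg_nonneg prod_nonneg)
qed

lemma meas_w: "k \<in> {1..d} \<Longrightarrow> (\<lambda>x. w x k) \<in> borel_measurable (\<Pi>\<^sub>M j\<in>{1..d}. N)"
  by (rule borel_measurable_spike_density) simp_all

text \<open>One dominating measure serves every spike position \<open>k\<close>; only the weight
  \<open>w x k\<close> depends on \<open>k\<close>. Risks at different one-sparse vectors thus
  become integrals over the same space, which can be added under the integral.\<close>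

lemma obs_law_unit_vec:
  assumes k: "k \<in> {1..d}"
  shows "obs_law d P0 P1 (unit_vec d k) = density (\<Pi>\<^sub>M j\<in>{1..d}. N) (\<lambda>x. ennreal (w x k))"
proof -
  interpret finite_measure N by (rule finite_measure_N)
  interpret N: product_sigma_finite "\<lambda>_. N" by standard
  define h where "h = (\<lambda>j x. ennreal (if j = k then g1 x else g0 x))"
  have dens: "density N (h j) = (if j = k then P1 else P0)" for j
    by (simp add: h_def P_eq_density_N)
  have meas_h: "h j \<in> borel_measurable N" for j
    unfolding h_def by (cases "j = k") simp_all
  have "obs_law d P0 P1 (unit_vec d k) = (\<Pi>\<^sub>M j\<in>{1..d}. density N (h j))"
    unfolding obs_law_def by (intro PiM_cong refl) (simp add: unit_vec_def dens)
  also have "\<dots> = density (\<Pi>\<^sub>M j\<in>{1..d}. N) (\<lambda>x. \<Prod>j\<in>{1..d}. h j (x j))"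
  proof (rule N.PiM_density)
    show "h j \<in> borel_measurable N" for j
      by (rule meas_h)
    show "sigma_finite_measure (density N (h j))" for j
      by (simp add: dens prob_P0 prob_P1 prob_space_imp_sigma_finite)
  qed simp
  also have "\<dots> = density (\<Pi>\<^sub>M j\<in>{1..d}. N) (\<lambda>x. ennreal (w x k))"
  proof (intro density_cong AE_I2)
    show "(\<lambda>x. \<Prod>j\<in>{1..d}. h j (x j)) \<in> borel_measurable (\<Pi>\<^sub>M j\<in>{1..d}. N)"
    proof (rule borel_measurable_prod_ennreal)
      fix j assume "j \<in> {1..d}"
      then show "(\<lambda>x. h j (x j)) \<in> borel_measurable (\<Pi>\<^sub>M j\<in>{1..d}. N)"
        by (rule measurable_compose[OF measurable_component_singleton[where M = "\<lambda>_. N"] meas_h])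
    qed
    show "(\<lambda>x. ennreal (w x k)) \<in> borel_measurable (\<Pi>\<^sub>M j\<in>{1..d}. N)"
      using meas_w[OF k] by measurable
    fix x assume "x \<in> space (\<Pi>\<^sub>M j\<in>{1..d}. N)"
    then have "x j \<in> space \<mu>" if "j \<in> {1..d}" for j
      using that by (auto simp: space_PiM)
    then have "(\<Prod>j\<in>{1..d}. h j (x j)) = ennreal (\<Prod>j\<in>{1..d}. if j = k then g1 (x j) else g0 (x j))"
      unfolding h_def by (intro prod_ennreal) (simp add: nonneg_g)
    \<comment> \<open>Splitting off the factor at \<open>k\<close> leaves \<open>g0\<close> at all
      other indices.\<close>
    also have "(\<Prod>j\<in>{1..d}. if j = k then g1 (x j) else g0 (x j)) = w x k"
      using k by (simp add: prod.remove[of _ k] spike_density_def)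
    finally show "(\<Prod>j\<in>{1..d}. h j (x j)) = ennreal (w x k)" .
  qed
  finally show ?thesis .
qed

section \<open>Risks as weighted integrals, and Bayes optimality\<close>

lemma has_bochner_integral_risk:
  assumes s: "(Z, t) \<in> selectors d \<mu>" and k: "k \<in> {1..d}"
  shows "has_bochner_integral ((\<Pi>\<^sub>M j\<in>{1..d}. N) \<Otimes>\<^sub>M Z)
    (\<lambda>\<omega>. w (fst \<omega>) k * hamming d (t \<omega>) (unit_vec d k)) (risk d P0 P1 (Z, t) (unit_vec d k))"
proof -
  let ?W = "(\<Pi>\<^sub>M j\<in>{1..d}. N) \<Otimes>\<^sub>M Z"
  interpret Z: prob_space Z using s by (simp add: selectors_def)
  interpret finite_measure N by (rule finite_measure_N)
  interpret N: product_sigma_finite "\<lambda>_. N" by standard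
  interpret L: prob_space "obs_law d P0 P1 (unit_vec d k)" by (rule prob_space_obs_law)
  interpret LZ: pair_prob_space "obs_law d P0 P1 (unit_vec d k)" Z ..
  have w: "(\<lambda>\<omega>. w (fst \<omega>) k) \<in> borel_measurable ?W"
    by (rule measurable_compose[OF measurable_fst meas_w[OF k]])
  have law: "obs_law d P0 P1 (unit_vec d k) \<Otimes>\<^sub>M Z = density ?W (\<lambda>\<omega>. ennreal (w (fst \<omega>) k))"
    unfolding obs_law_unit_vec[OF k]
    by (intro density_pair_fst Z.sigma_finite_measure_axioms N.sigma_finite
        measurable_compose[OF meas_w[OF k] measurable_ennreal]) simp
  have "sets ?W = sets ((\<Pi>\<^sub>M j\<in>{1..d}. \<mu>) \<Otimes>\<^sub>M Z)"
    by (intro sets_pair_measure_cong sets_PiM_cong) simp_all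
  then have "t \<in> ?W \<rightarrow>\<^sub>M (\<Pi>\<^sub>M j\<in>{1..d}. count_space {0, 1})"
    using s by (simp only: selectors_def mem_Collect_eq prod.case cong: measurable_cong_sets)
  from borel_measurable_hamming[OF this]
  have H: "(\<lambda>\<omega>. hamming d (t \<omega>) (unit_vec d k)) \<in> borel_measurable ?W" .
  have nonneg: "AE \<omega> in ?W. 0 \<le> w (fst \<omega>) k"
    using k by (intro AE_I2) (auto simp: space_pair_measure nonneg_w)
  \<comment> \<open>Integrability is checked under the probability law, where the loss is bounded by
    \<open>d\<close>; the density then transfers it to the weighted integrand.\<close>
  have "integrable (obs_law d P0 P1 (unit_vec d k) \<Otimes>\<^sub>M Z) (\<lambda>\<omega>. hamming d (t \<omega>) (unit_vec d k))"
  proof (rule LZ.integrable_const_bound[where B = d])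
    show "AE \<omega> in obs_law d P0 P1 (unit_vec d k) \<Otimes>\<^sub>M Z. norm (hamming d (t \<omega>) (unit_vec d k)) \<le> d"
      by (simp add: hamming_nonneg hamming_le)
    show "(\<lambda>\<omega>. hamming d (t \<omega>) (unit_vec d k))
        \<in> borel_measurable (obs_law d P0 P1 (unit_vec d k) \<Otimes>\<^sub>M Z)"
      unfolding law using H by simp
  qed
  then show ?thesis
    unfolding has_bochner_integral_iff risk_def fst_conv snd_conv law
      integrable_density[OF H w nonneg] integral_density[OF H w nonneg] real_scaleR_def
    by simp
qed

text \<open>Both sums of risks are single integrals over one measure, and
  \<open>eta_star_minimises\<close> compares the integrands at every point.\<close>

lemma sum_risk_star_le:
  assumes Z: "prob_space Z" and s: "s \<in> selectors d \<mu>"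
  shows "(\<Sum>k=1..d. risk d P0 P1 (star_selector d f0 f1 Z) (unit_vec d k))
    \<le> (\<Sum>k=1..d. risk d P0 P1 s (unit_vec d k))"
proof -
  obtain Z' t where s_eq: "s = (Z', t)" by (cases s)
  with s have Z': "prob_space Z'"
    and t: "t \<in> (\<Pi>\<^sub>M j\<in>{1..d}. \<mu>) \<Otimes>\<^sub>M Z' \<rightarrow>\<^sub>M (\<Pi>\<^sub>M j\<in>{1..d}. count_space {0, 1})"
    by (auto simp: selectors_def)
  let ?W = "(\<Pi>\<^sub>M j\<in>{1..d}. N) \<Otimes>\<^sub>M Z'"
  let ?t = "\<lambda>\<omega>. eta_star d f0 f1 (fst \<omega>)"
  let ?S = "\<lambda>t \<omega>. \<Sum>k=1..d. w (fst \<omega>) k * hamming d (t \<omega>) (unit_vec d k)"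
  have space_W: "space ?W = space ((\<Pi>\<^sub>M j\<in>{1..d}. \<mu>) \<Otimes>\<^sub>M Z')"
    by (simp add: space_pair_measure space_PiM)
  have star: "star_selector d f0 f1 Z' \<in> selectors d \<mu>"
    by (rule star_selector_in_selectors[OF Z'])
  have "has_bochner_integral ?W (?S t) (\<Sum>k=1..d. risk d P0 P1 (Z', t) (unit_vec d k))"
    if "(Z', t) \<in> selectors d \<mu>" for t
    using has_bochner_integral_risk[OF that] by (intro has_bochner_integral_sum)
  then have int: "integrable ?W (?S t)"
    and risk: "(\<Sum>k=1..d. risk d P0 P1 (Z', t) (unit_vec d k)) = integral\<^sup>L ?W (?S t)"
    if "(Z', t) \<in> selectors d \<mu>" for t
    using that by (simp_all add: has_bochner_integral_iff)
  have sel: "(Z', ?t) \<in> selectors d \<mu>" "(Z', t) \<in> selectors d \<mu>"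
    using star s s_eq by (simp_all add: star_selector_def)
  \<comment> \<open>The competitor has its own randomization law \<open>Z'\<close>. Moving
    \<open>eta_star\<close> to \<open>Z'\<close> places both integrands on the same space.\<close>
  have "(\<Sum>k=1..d. risk d P0 P1 (star_selector d f0 f1 Z) (unit_vec d k))
      = (\<Sum>k=1..d. risk d P0 P1 (Z', ?t) (unit_vec d k))"
    unfolding risk_star_selector[OF Z] risk_star_selector[OF Z', unfolded star_selector_def] ..
  also have "\<dots> \<le> (\<Sum>k=1..d. risk d P0 P1 s (unit_vec d k))"
    unfolding s_eq risk[OF sel(1)] risk[OF sel(2)]
  proof (rule integral_mono[OF int[OF sel(1)] int[OF sel(2)]])
    fix \<omega> assume \<omega>: "\<omega> \<in> space ?W"
    then have x: "fst \<omega> i \<in> space \<mu>" if "i \<in> {1..d}" for i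
      using that by (auto simp: space_pair_measure space_PiM)
    have "t \<omega> \<in> {1..d} \<rightarrow>\<^sub>E {0, 1}"
      using measurable_space[OF t] \<omega> unfolding space_W by (simp add: space_PiM)
    \<comment> \<open>Each spike density is a product with one factor per coordinate, and
      \<open>f_eq\<close> extracts \<open>f0 + f1\<close> from every factor. The extracted product
      is the same for all spikes.\<close>
    moreover define C where "C = (\<Prod>i\<in>{1..d}. f0 (fst \<omega> i) + f1 (fst \<omega> i))"
    moreover have "0 \<le> C"
      unfolding C_def by (intro prod_nonneg) (simp add: x nonneg_f0 nonneg_f1)
    moreover have "spike_density d f0 f1 (fst \<omega>) k = C * w (fst \<omega>) k" if k: "k \<in> {1..d}" for k
    proof -
      have C: "C = (f0 (fst \<omega> k) + f1 (fst \<omega> k))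
          * (\<Prod>i\<in>{1..d} - {k}. f0 (fst \<omega> i) + f1 (fst \<omega> i))"
        unfolding C_def using k by (simp add: prod.remove)
      have "spike_density d f0 f1 (fst \<omega>) k = ((f0 (fst \<omega> k) + f1 (fst \<omega> k)) * g1 (fst \<omega> k))
          * (\<Prod>i\<in>{1..d} - {k}. (f0 (fst \<omega> i) + f1 (fst \<omega> i)) * g0 (fst \<omega> i))"
        unfolding spike_density_def
        by (intro arg_cong2[where f = "(*)"] prod.cong refl f_eq x k) blast
      also have "\<dots> = C * w (fst \<omega>) k"
        by (simp only: prod.distrib C spike_density_def mult_ac)
      finally show ?thesis .
    qed
    \<comment> \<open>If \<open>C\<close> vanishes, some coordinate has \<open>f0 + f1\<close> equal
      to 0, hence both quotients are 0 there. One of them is a factor of the weight, whether or not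
      that coordinate carries the spike.\<close>
    moreover have "w (fst \<omega>) k = 0" if k: "k \<in> {1..d}" and "C = 0" for k
    proof -
      obtain i where i: "i \<in> {1..d}" "f0 (fst \<omega> i) + f1 (fst \<omega> i) = 0"
        using \<open>C = 0\<close> unfolding C_def by auto
      then have g: "g0 (fst \<omega> i) = 0" "g1 (fst \<omega> i) = 0"
        by (simp_all add: g0_def g1_def)
      show ?thesis
      proof (cases "i = k")
        case True
        then show ?thesis using g by (simp add: spike_density_def)
      next
        case False
        then have "(\<Prod>i\<in>{1..d} - {k}. g0 (fst \<omega> i)) = 0"
          using i g by (intro prod_zero) auto
        then show ?thesis by (simp add: spike_density_def)
      qed
    qed
    ultimately show "?S ?t \<omega> \<le> ?S t \<omega>"
      by (intro eta_star_minimises)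
  qed
  finally show ?thesis .
qed

end

section \<open>Uniform prior, average risk and the minimax conclusion\<close>

lemma sum_one_sparse: "(\<Sum>\<eta>\<in>one_sparse d. R \<eta>) = (\<Sum>k=1..d. R (unit_vec d k))"
  unfolding one_sparse_eq by (simp only: sum.reindex[OF inj_on_unit_vec] o_def)

lemma card_one_sparse: "card (one_sparse d) = d"
  unfolding one_sparse_eq by (simp only: card_image[OF inj_on_unit_vec] card_atLeastAtMost diff_Suc_1)

lemma bayes_risk_eq:
  assumes "0 < d"
  shows "bayes_risk d P0 P1 s = (\<Sum>k=1..d. risk d P0 P1 s (unit_vec d k)) / d"
proof -
  have "one_sparse d \<noteq> {}" "finite (one_sparse d)"
    using assms by (auto simp: one_sparse_eq)
  then show ?thesis
    unfolding bayes_risk_def by (simp add: integral_pmf_of_set sum_one_sparse card_one_sparse)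
qed

text \<open>An average is at most the supremum, which is a genuine upper bound because there are
  only finitely many one-sparse vectors.\<close>

lemma bayes_risk_le_SUP:
  assumes "0 < d"
  shows "bayes_risk d P0 P1 s \<le> (SUP \<eta> \<in> one_sparse d. risk d P0 P1 s \<eta>)" (is "_ \<le> ?S")
proof -
  have "(\<Sum>k=1..d. risk d P0 P1 s (unit_vec d k)) \<le> of_nat (card {1..d}) * ?S"
    by (intro sum_bounded_above cSUP_upper) (auto simp: one_sparse_eq)
  then show ?thesis
    using assms by (simp add: bayes_risk_eq field_simps)
qed

theorem theorem2:
  fixes d :: nat
    and \<mu> P0 P1 :: "'a measure"
    and f0 f1 :: "'a \<Rightarrow> real"
    and Z :: "'z measure"
  assumes "d > 2"
    and "prob_space P0" and "prob_space P1" and "P0 \<noteq> P1"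
    and "f0 \<in> borel_measurable \<mu>" and "\<And>x. x \<in> space \<mu> \<Longrightarrow> 0 \<le> f0 x"
    and "f1 \<in> borel_measurable \<mu>" and "\<And>x. x \<in> space \<mu> \<Longrightarrow> 0 \<le> f1 x"
    and "P0 = density \<mu> (\<lambda>x. ennreal (f0 x))" and "P1 = density \<mu> (\<lambda>x. ennreal (f1 x))"
    and "prob_space Z"
  shows
    "star_selector d f0 f1 Z \<in> selectors d \<mu>
     \<and> (INF s \<in> (selectors d \<mu> :: ('z measure \<times> ((nat \<Rightarrow> 'a) \<times> 'z \<Rightarrow> nat \<Rightarrow> nat)) set).
          SUP \<eta> \<in> one_sparse d. risk d P0 P1 s \<eta>)
        = (SUP \<eta> \<in> one_sparse d. risk d P0 P1 (star_selector d f0 f1 Z) \<eta>)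
     \<and> (SUP \<eta> \<in> one_sparse d. risk d P0 P1 (star_selector d f0 f1 Z) \<eta>)
        = risk d P0 P1 (star_selector d f0 f1 Z) (e1 d)
     \<and> (INF s \<in> (selectors d \<mu> :: ('z measure \<times> ((nat \<Rightarrow> 'a) \<times> 'z \<Rightarrow> nat \<Rightarrow> nat)) set).
          bayes_risk d P0 P1 s)
        = bayes_risk d P0 P1 (star_selector d f0 f1 Z)
     \<and> bayes_risk d P0 P1 (star_selector d f0 f1 Z)
        = risk d P0 P1 (star_selector d f0 f1 Z) (e1 d)"
proof -
  interpret pivotal_selection d \<mu> P0 P1 f0 f1
    using assms(1) by (intro pivotal_selection.intro assms) simp
  let ?s = "star_selector d f0 f1 Z"
  let ?R = "risk d P0 P1 ?s (e1 d)"
  let ?sup = "\<lambda>s :: 'z measure \<times> ((nat \<Rightarrow> 'a) \<times> 'z \<Rightarrow> nat \<Rightarrow> nat). SUP \<eta> \<in> one_sparse d. risk d P0 P1 s \<eta>"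
  have Z: "prob_space Z" by fact
  have star: "?s \<in> selectors d \<mu>"
    by (rule star_selector_in_selectors[OF Z])
  have const: "risk d P0 P1 ?s (unit_vec d k) = ?R" if "k \<in> {1..d}" for k
    by (rule risk_star_selector_unit_vec[OF Z that])
  have bayes_star: "bayes_risk d P0 P1 ?s = ?R"
    using d_pos by (simp add: bayes_risk_eq const)
  have bayes_le: "bayes_risk d P0 P1 ?s \<le> bayes_risk d P0 P1 s"
    if "s \<in> selectors d \<mu>" for s :: "'z measure \<times> ((nat \<Rightarrow> 'a) \<times> 'z \<Rightarrow> nat \<Rightarrow> nat)"
    unfolding bayes_risk_eq[OF d_pos] using sum_risk_star_le[OF Z that]
    by (rule divide_right_mono) simp
  \<comment> \<open>Constant risk on a nonempty index set makes the image a singleton, so the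
    supremum is that constant.\<close>
  have "risk d P0 P1 ?s ` one_sparse d = {?R}"
    using const d_pos by (auto simp: one_sparse_eq image_image intro!: image_eqI[of _ _ 1])
  then have sup_star: "?sup ?s = ?R" by simp
  have minimax: "(INF s \<in> selectors d \<mu>. ?sup s) = ?sup ?s"
  \<comment> \<open>The infimum is attained at \<open>eta_star\<close>, so membership and the lower
    bound determine it: the worst-case risk of \<open>eta_star\<close> equals its Bayes risk, which
    is at most the Bayes risk of \<open>s\<close> and hence at most the worst-case risk of
    \<open>s\<close>.\<close>
  proof (rule cInf_eq_minimum)
    show "?sup ?s \<in> ?sup ` selectors d \<mu>"
      using star by (rule imageI)
    fix r assume "r \<in> ?sup ` selectors d \<mu>"
    then obtain s :: "'z measure \<times> ((nat \<Rightarrow> 'a) \<times> 'z \<Rightarrow> nat \<Rightarrow> nat)"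
      where "s \<in> selectors d \<mu>" and r: "r = ?sup s" by blast
    then have "?sup ?s \<le> bayes_risk d P0 P1 s"
      using bayes_le unfolding sup_star bayes_star by blast
    also have "\<dots> \<le> r"
      unfolding r by (rule bayes_risk_le_SUP[OF d_pos])
    finally show "?sup ?s \<le> r" .
  qed
  have bayes: "(INF s \<in> (selectors d \<mu> :: ('z measure \<times> ((nat \<Rightarrow> 'a) \<times> 'z \<Rightarrow> nat \<Rightarrow> nat)) set). bayes_risk d P0 P1 s) = bayes_risk d P0 P1 ?s"
    using star bayes_le by (intro cInf_eq_minimum) auto
  from star minimax sup_star bayes bayes_star show ?thesis by blast
qed

end
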